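(* Let $n\ge 2$ and let $SB_n$ be the singular braid monoid (Baez--Birman monoid) on $n$ strings, with standard generators $\sigma_i,\sigma_i^{-1},x_i$ ($1\le i\le n-1$). Put $\sigma=\sigma_1\sigma_2\cdots\sigma_{n-1}$. Then $SB_n$ has a monoid presentation with generators $\sigma_1,\ \sigma_1^{-1},\ \sigma,\ \sigma^{-1},\ x_1$ and relations $$\begin{cases} \sigma_1\sigma^i\sigma_1\sigma^{-i}=\sigma^i\sigma_1\sigma^{-i}\sigma_1 & \text{for } 2\le i\le n/2,\\ \sigma^n=(\sigma\sigma_1)^{n-1},\\ x_1\sigma^i\sigma_1\sigma^{-i}=\sigma^i\sigma_1\sigma^{-i}x_1 & \text{for } i=0,2,\dots,n-2 \ (\text{i.e. } i=0 \text{ and all } 2\le i\le n-2),\\ x_1\sigma^i x_1\sigma^{-i}=\sigma^i x_1\sigma^{-i}x_1 & \text{for } 2\le i\le n/2,\\ \sigma^n x_1=x_1\sigma^n,\\ x_1\sigma\sigma_1\sigma^{-1}\sigma_1=\sigma\sigma_1\sigma^{-1}\sigma_1\sigma x_1\sigma^{-1},\\ \sigma_1\sigma_1^{-1}=\sigma_1^{-1}\sigma_1=1,\\ \sigma\sigma^{-1}=\sigma^{-1}\sigma=1. \end{cases}$$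
   Context: The singular braid monoid $SB_n$ is the monoid with generators $\sigma_i,\sigma_i^{-1},x_i$, $i=1,\dots,n-1$, and relations: $\sigma_i\sigma_j=\sigma_j\sigma_i$ if $|i-j|>1$; $x_ix_j=x_jx_i$ if $|i-j|>1$; $x_i\sigma_j=\sigma_jx_i$ if $|i-j|\ne 1$; $\sigma_i\sigma_{i+1}\sigma_i=\sigma_{i+1}\sigma_i\sigma_{i+1}$, $\sigma_i\sigma_{i+1}x_i=x_{i+1}\sigma_i\sigma_{i+1}$ and $\sigma_{i+1}\sigma_ix_{i+1}=x_i\sigma_{i+1}\sigma_i$ for $1\le i\le n-2$; $\sigma_i\sigma_i^{-1}=\sigma_i^{-1}\sigma_i=1$ for all $i$. Here $\sigma^{-i}$ denotes $(\sigma^{-1})^i$. "Presentation" means monoid presentation, the generator symbols being interpreted as the elements of $SB_n$ with the same names, with $\sigma=\sigma_1\cdots\sigma_{n-1}$ and $\sigma^{-1}=\sigma_{n-1}^{-1}\cdots\sigma_1^{-1}$. *)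

theory Defs
  imports "HOL-Algebra.Group"
begin

text \<open>
  Words over a set \<open>A\<close> of letters are the elements of \<^term>\<open>lists A\<close>, the carrier of the free
  monoid on \<open>A\<close>.
\<close>

inductive_set word_cong :: "'a set \<Rightarrow> ('a list \<times> 'a list) set \<Rightarrow> ('a list \<times> 'a list) set"
  for A :: "'a set" and R :: "('a list \<times> 'a list) set"
where
  step: "\<lbrakk>(u, v) \<in> R; p \<in> lists A; q \<in> lists A\<rbrakk> \<Longrightarrow> (p @ u @ q, p @ v @ q) \<in> word_cong A R"
| refl: "w \<in> lists A \<Longrightarrow> (w, w) \<in> word_cong A R"
| sym: "(u, v) \<in> word_cong A R \<Longrightarrow> (v, u) \<in> word_cong A R"
| trans: "\<lbrakk>(u, v) \<in> word_cong A R; (v, w) \<in> word_cong A R\<rbrakk> \<Longrightarrow> (u, w) \<in> word_cong A R"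

definition word_class :: "'a set \<Rightarrow> ('a list \<times> 'a list) set \<Rightarrow> 'a list \<Rightarrow> 'a list set" where
  "word_class A R w = word_cong A R `` {w}"

definition presented_monoid :: "'a set \<Rightarrow> ('a list \<times> 'a list) set \<Rightarrow> 'a list set monoid" where
  "presented_monoid A R =
    \<lparr>carrier = lists A // word_cong A R,
     mult = (\<lambda>U V. \<Union>u\<in>U. \<Union>v\<in>V. word_class A R (u @ v)),
     one = word_class A R []\<rparr>"

text \<open>
  \<open>M\<close> is presented by the generators \<open>A\<close> and the relations \<open>R\<close>, where the symbol \<open>a \<in> A\<close> denotes
  the element \<open>\<phi> a\<close> of \<open>M\<close>.
\<close>

definition has_monoid_presentation ::
  "('m, 'x) monoid_scheme \<Rightarrow> 'a set \<Rightarrow> ('a list \<times> 'a list) set \<Rightarrow> ('a \<Rightarrow> 'm) \<Rightarrow> bool" where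
  "has_monoid_presentation M A R \<phi> \<longleftrightarrow>
    R \<subseteq> lists A \<times> lists A \<and>
    (\<exists>h \<in> iso (presented_monoid A R) M. \<forall>a\<in>A. h (word_class A R [a]) = \<phi> a)"

lemma word_cong_subset:
  assumes "R \<subseteq> lists A \<times> lists A"
  shows "word_cong A R \<subseteq> lists A \<times> lists A"
proof -
  have "u \<in> lists A \<and> v \<in> lists A" if "(u, v) \<in> word_cong A R" for u v
    using that by (induction rule: word_cong.induct) (use assms in auto)
  then show ?thesis by auto
qed

lemma equiv_word_cong:
  assumes "R \<subseteq> lists A \<times> lists A"
  shows "equiv (lists A) (word_cong A R)"
  using word_cong_subset[OF assms]
  by (intro equivI refl_onI symI transI)
    (simp_all add: word_cong.refl, (blast intro: word_cong.sym word_cong.trans)+)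

lemma word_cong_context:
  assumes "(u, v) \<in> word_cong A R" "p \<in> lists A" "q \<in> lists A"
  shows "(p @ u @ q, p @ v @ q) \<in> word_cong A R"
  using assms
proof (induction rule: word_cong.induct)
  case (step u v p' q')
  then have "p @ p' \<in> lists A" "q' @ q \<in> lists A" by auto
  from word_cong.step[OF step(1) this] show ?case by simp
next
  case (refl w)
  then show ?case by (simp add: word_cong.refl)
qed (blast intro: word_cong.sym word_cong.trans)+

lemma word_cong_append:
  assumes R: "R \<subseteq> lists A \<times> lists A"
    and "(u, u') \<in> word_cong A R" "(v, v') \<in> word_cong A R"
  shows "(u @ v, u' @ v') \<in> word_cong A R"
proof -
  have "u' \<in> lists A" "v \<in> lists A" using assms word_cong_subset[OF R] by auto
  then have "(u @ v, u' @ v) \<in> word_cong A R" "(u' @ v, u' @ v') \<in> word_cong A R"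
    using word_cong_context[OF assms(2), of "[]" v] word_cong_context[OF assms(3), of u' "[]"]
    by auto
  then show ?thesis by (rule word_cong.trans)
qed

lemma word_class_mult:
  assumes R: "R \<subseteq> lists A \<times> lists A" and "u \<in> lists A" "v \<in> lists A"
  shows "word_class A R u \<otimes>\<^bsub>presented_monoid A R\<^esub> word_class A R v = word_class A R (u @ v)"
proof -
  have "word_class A R (u' @ v') = word_class A R (u @ v)"
    if "u' \<in> word_class A R u" "v' \<in> word_class A R v" for u' v'
    using that equiv_class_eq[OF equiv_word_cong[OF R] word_cong_append[OF R, of u u' v v']]
    by (simp add: word_class_def)
  moreover have "word_class A R u \<noteq> {}" "word_class A R v \<noteq> {}"
    using word_cong.refl[OF assms(2), of R] word_cong.refl[OF assms(3), of R]
    unfolding word_class_def by blast+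
  ultimately show ?thesis by (simp add: presented_monoid_def)
qed

lemma monoid_presented_monoid:
  assumes R: "R \<subseteq> lists A \<times> lists A"
  shows "monoid (presented_monoid A R)"
proof -
  have carrier: "carrier (presented_monoid A R) = word_class A R ` lists A"
    by (auto simp: presented_monoid_def word_class_def quotient_def)
  have one: "\<one>\<^bsub>presented_monoid A R\<^esub> = word_class A R []"
    by (simp add: presented_monoid_def)
  have mult: "word_class A R u \<otimes>\<^bsub>presented_monoid A R\<^esub> word_class A R v = word_class A R (u @ v)"
    if "\<forall>x\<in>set u. x \<in> A" "\<forall>x\<in>set v. x \<in> A" for u v
    using that by (auto intro!: word_class_mult[OF R])
  show ?thesis
    by (rule monoidI) (auto simp: carrier one mult ball_Un intro!: imageI)
qed

datatype sb_gen = Sig nat | SigInv nat | X nat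

definition SB_gens :: "nat \<Rightarrow> sb_gen set" where
  "SB_gens n = Sig ` {1..<n} \<union> SigInv ` {1..<n} \<union> X ` {1..<n}"

inductive_set SB_rels :: "nat \<Rightarrow> (sb_gen list \<times> sb_gen list) set" for n :: nat where
  "\<lbrakk>i \<in> {1..<n}; j \<in> {1..<n}; \<bar>int i - int j\<bar> > 1\<rbrakk>
    \<Longrightarrow> ([Sig i, Sig j], [Sig j, Sig i]) \<in> SB_rels n"
| "\<lbrakk>i \<in> {1..<n}; j \<in> {1..<n}; \<bar>int i - int j\<bar> > 1\<rbrakk>
    \<Longrightarrow> ([X i, X j], [X j, X i]) \<in> SB_rels n"
| "\<lbrakk>i \<in> {1..<n}; j \<in> {1..<n}; \<bar>int i - int j\<bar> \<noteq> 1\<rbrakk>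
    \<Longrightarrow> ([X i, Sig j], [Sig j, X i]) \<in> SB_rels n"
| "\<lbrakk>1 \<le> i; i + 1 < n\<rbrakk>
    \<Longrightarrow> ([Sig i, Sig (i + 1), Sig i], [Sig (i + 1), Sig i, Sig (i + 1)]) \<in> SB_rels n"
| "\<lbrakk>1 \<le> i; i + 1 < n\<rbrakk>
    \<Longrightarrow> ([Sig i, Sig (i + 1), X i], [X (i + 1), Sig i, Sig (i + 1)]) \<in> SB_rels n"
| "\<lbrakk>1 \<le> i; i + 1 < n\<rbrakk>
    \<Longrightarrow> ([Sig (i + 1), Sig i, X (i + 1)], [X i, Sig (i + 1), Sig i]) \<in> SB_rels n"
| "i \<in> {1..<n} \<Longrightarrow> ([Sig i, SigInv i], []) \<in> SB_rels n"
| "i \<in> {1..<n} \<Longrightarrow> ([SigInv i, Sig i], []) \<in> SB_rels n"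

definition SB :: "nat \<Rightarrow> sb_gen list set monoid" where
  "SB n = presented_monoid (SB_gens n) (SB_rels n)"

abbreviation SB_class :: "nat \<Rightarrow> sb_gen list \<Rightarrow> sb_gen list set" where
  "SB_class n \<equiv> word_class (SB_gens n) (SB_rels n)"

lemma SB_rels_subset: "SB_rels n \<subseteq> lists (SB_gens n) \<times> lists (SB_gens n)"
proof -
  have "u \<in> lists (SB_gens n) \<and> v \<in> lists (SB_gens n)" if "(u, v) \<in> SB_rels n" for u v
    using that by cases (auto simp: SB_gens_def)
  then show ?thesis by auto
qed

lemma monoid_SB: "monoid (SB n)"
  unfolding SB_def by (rule monoid_presented_monoid[OF SB_rels_subset])

text \<open>The letters \<open>S\<close> and \<open>SInv\<close> stand for \<open>\<sigma> = \<sigma>\<^sub>1 \<dots> \<sigma>\<^sub>n\<^sub>-\<^sub>1\<close> and its inverse.\<close>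

datatype sb_gen' = S1 | S1Inv | S | SInv | X1

abbreviation word_pow :: "'a list \<Rightarrow> nat \<Rightarrow> 'a list" where
  "word_pow w k \<equiv> concat (replicate k w)"

text \<open>\<open>shift i w\<close> is the word \<open>\<sigma>\<^sup>i w \<sigma>\<^sup>-\<^sup>i\<close>.\<close>

definition shift :: "nat \<Rightarrow> sb_gen' list \<Rightarrow> sb_gen' list" where
  "shift i w = word_pow [S] i @ w @ word_pow [SInv] i"

inductive_set SB_rels' :: "nat \<Rightarrow> (sb_gen' list \<times> sb_gen' list) set" for n :: nat where
  "\<lbrakk>2 \<le> i; 2 * i \<le> n\<rbrakk> \<Longrightarrow> ([S1] @ shift i [S1], shift i [S1] @ [S1]) \<in> SB_rels' n"
| "(word_pow [S] n, word_pow [S, S1] (n - 1)) \<in> SB_rels' n"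
| "i = 0 \<or> 2 \<le> i \<and> i + 2 \<le> n \<Longrightarrow> ([X1] @ shift i [S1], shift i [S1] @ [X1]) \<in> SB_rels' n"
| "\<lbrakk>2 \<le> i; 2 * i \<le> n\<rbrakk> \<Longrightarrow> ([X1] @ shift i [X1], shift i [X1] @ [X1]) \<in> SB_rels' n"
| "(word_pow [S] n @ [X1], [X1] @ word_pow [S] n) \<in> SB_rels' n"
| "([X1, S, S1, SInv, S1], [S, S1, SInv, S1, S, X1, SInv]) \<in> SB_rels' n"
| "([S1, S1Inv], []) \<in> SB_rels' n"
| "([S1Inv, S1], []) \<in> SB_rels' n"
| "([S, SInv], []) \<in> SB_rels' n"
| "([SInv, S], []) \<in> SB_rels' n"

fun SB_interp :: "nat \<Rightarrow> sb_gen' \<Rightarrow> sb_gen list set" where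
  "SB_interp n S1 = SB_class n [Sig 1]"
| "SB_interp n S1Inv = SB_class n [SigInv 1]"
| "SB_interp n S = SB_class n (map Sig [1..<n])"
| "SB_interp n SInv = SB_class n (map SigInv (rev [1..<n]))"
| "SB_interp n X1 = SB_class n [X 1]"

end

theory Submission imports Defs begin

text \<open>
  By Tietze's criterion it suffices to derive each set of relations from the other under mutually
  inverse substitutions; the old generators become \<open>\<sigma>\<^sub>i = \<sigma>\<^sup>i\<^sup>-\<^sup>1 \<sigma>\<^sub>1 \<sigma>\<^sup>1\<^sup>-\<^sup>i\<close> and
  \<open>x\<^sub>i = \<sigma>\<^sup>i\<^sup>-\<^sup>1 x\<^sub>1 \<sigma>\<^sup>1\<^sup>-\<^sup>i\<close>. Given these formulas, \<open>\<sigma>\<^sup>n = (\<sigma>\<sigma>\<^sub>1)\<^sup>n\<^sup>-\<^sup>1\<close> is equivalent to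
  \<open>\<sigma> = \<sigma>\<^sub>1 \<dots> \<sigma>\<^sub>n\<^sub>-\<^sub>1\<close>, and with \<open>\<sigma>\<^sup>n x\<^sub>1 = x\<^sub>1 \<sigma>\<^sup>n\<close> it makes \<open>\<sigma>\<^sup>n\<close> central, so that indices may be read modulo \<open>n\<close> and the
  commutations with \<open>i \<le> n/2\<close> give all of them. The braid relations follow by cancelling
  \<open>\<sigma>\<^sub>3 \<dots> \<sigma>\<^sub>n\<^sub>-\<^sub>1\<close> in \<open>\<sigma> \<sigma>\<^sub>1 = \<sigma>\<^sub>2 \<sigma>\<close> and \<open>\<sigma> x\<^sub>1 = x\<^sub>2 \<sigma>\<close>.

  Congruence of words is tested on actions of the free monoid by self-maps of a type, so that
  associativity and cancellation are plain function application. The left regular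
  action of the presented monoid shows that these tests are sufficient.
\<close>

section \<open>Words acting on a type\<close>

lemma foldr_word_pow: "foldr k (word_pow w m) = (foldr k w) ^^ m"
  by (induction m) (auto simp: fun_eq_iff)

lemma foldr_concat_map: "foldr k (concat (map f w)) = foldr (\<lambda>b. foldr k (f b)) w"
  by (induction w) (auto simp: fun_eq_iff)

lemma foldr_commute:
  assumes "\<And>j. j \<in> set js \<Longrightarrow> k j \<circ> f = f \<circ> k j"
  shows "foldr k js \<circ> f = f \<circ> foldr k js"
  using assms by (induction js) (auto simp: fun_eq_iff)

lemma surj_foldr:
  assumes "\<And>j. j \<in> set js \<Longrightarrow> surj (k j)"
  shows "surj (foldr k js)"
  using assms
proof (induction js)
  case (Cons j js)
  then have "surj (k j \<circ> foldr k js)" by (intro comp_surj) simp_all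
  then show ?case by (simp only: foldr.simps)
qed (simp add: id_def)

lemma foldr_map_fun: "foldr k (map f js) = foldr (\<lambda>j. k (f j)) js"
  by (induction js) (simp_all add: fun_eq_iff)

lemma foldr_inverse:
  assumes "\<And>j. j \<in> set js \<Longrightarrow> k j \<circ> l j = id"
  shows "foldr k js \<circ> foldr l (rev js) = id"
  using assms by (induction js) (auto simp: fun_eq_iff)

section \<open>Word congruence tested by actions\<close>

lemma word_class_eq_iff:
  assumes R: "R \<subseteq> lists A \<times> lists A" and "u \<in> lists A" "v \<in> lists A"
  shows "word_class A R u = word_class A R v \<longleftrightarrow> (u, v) \<in> word_cong A R"
  unfolding word_class_def using eq_equiv_class_iff[OF equiv_word_cong[OF R]] assms by auto

lemma word_cong_act:
  assumes "(u, v) \<in> word_cong A R" "\<And>p q. (p, q) \<in> R \<Longrightarrow> foldr k p = foldr k q"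
  shows "foldr k u = foldr k v"
  using assms(1) by induction (simp_all add: assms(2) fun_eq_iff)

text \<open>Acting as the identity off the carrier makes each letter a total map, and every relation
  holds there trivially.\<close>

definition left_regular ::
  "'a set \<Rightarrow> ('a list \<times> 'a list) set \<Rightarrow> 'a \<Rightarrow> 'a list set \<Rightarrow> 'a list set" where
  "left_regular A R a U =
    (if U \<in> carrier (presented_monoid A R)
     then word_class A R [a] \<otimes>\<^bsub>presented_monoid A R\<^esub> U else U)"

lemma carrier_presented_monoid:
  "carrier (presented_monoid A R) = word_class A R ` lists A"
  by (auto simp: presented_monoid_def word_class_def quotient_def)

lemma foldr_left_regular:
  assumes R: "R \<subseteq> lists A \<times> lists A" and "u \<in> lists A" "w \<in> lists A"
  shows "foldr (left_regular A R) u (word_class A R w) = word_class A R (u @ w)"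
  using assms(2)
proof (induction u)
  case (Cons a u)
  then show ?case
    using word_class_mult[OF R, of "[a]" "u @ w"] assms(3)
    by (auto simp: left_regular_def carrier_presented_monoid)
qed simp

lemma foldr_left_regular_outside:
  assumes "U \<notin> carrier (presented_monoid A R)"
  shows "foldr (left_regular A R) u U = U"
  using assms by (induction u) (auto simp: left_regular_def)

text \<open>A premise cannot quantify over types, so the test type is the one carrying the left
  regular action; applying a word to the class of \<open>[]\<close> recovers its class.\<close>

lemma word_congI_act:
  fixes A :: "'a set"
  assumes R: "R \<subseteq> lists A \<times> lists A" and u: "u \<in> lists A" and v: "v \<in> lists A"
    and act: "\<And>k :: 'a \<Rightarrow> 'a list set \<Rightarrow> 'a list set.
      (\<And>p q. (p, q) \<in> R \<Longrightarrow> foldr k p = foldr k q) \<Longrightarrow> foldr k u = foldr k v"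
  shows "(u, v) \<in> word_cong A R"
proof -
  let ?k = "left_regular A R"
  have "foldr ?k p U = foldr ?k q U" if "(p, q) \<in> R" for p q U
  proof (cases "U \<in> carrier (presented_monoid A R)")
    case True
    then obtain w where w: "w \<in> lists A" "U = word_class A R w"
      by (auto simp: carrier_presented_monoid)
    have "p \<in> lists A" "q \<in> lists A" using that R by auto
    moreover have "(p @ w, q @ w) \<in> word_cong A R"
      using word_cong.step[OF that, of "[]" A w] w by simp
    ultimately show ?thesis
      using w word_class_eq_iff[OF R, of "p @ w" "q @ w"] by (simp add: foldr_left_regular[OF R])
  qed (simp add: foldr_left_regular_outside)
  then have "foldr ?k u (word_class A R []) = foldr ?k v (word_class A R [])"
    using act[of ?k] by (simp add: fun_eq_iff)
  then show ?thesis
    using word_class_eq_iff[OF R u v] foldr_left_regular[OF R u, of "[]"]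
      foldr_left_regular[OF R v, of "[]"]
    by simp
qed

text \<open>Tietze's criterion, where \<open>\<lambda>b. foldr k (f b)\<close> is the action
  \<open>k\<close> pulled back along the substitution \<open>f\<close>. By \<open>fQ\<close> and
  \<open>gR\<close> both substitutions respect the congruences; by \<open>fg\<close> and
  \<open>gf\<close> they are mutually inverse.\<close>

lemma has_monoid_presentationI:
  fixes A :: "'a set" and B :: "'b set" and f :: "'b \<Rightarrow> 'a list" and g :: "'a \<Rightarrow> 'b list"
  assumes R: "R \<subseteq> lists A \<times> lists A" and Q: "Q \<subseteq> lists B \<times> lists B"
    and f: "\<And>b. b \<in> B \<Longrightarrow> f b \<in> lists A" and g: "\<And>a. a \<in> A \<Longrightarrow> g a \<in> lists B"
    and fQ: "\<And>(k :: 'a \<Rightarrow> 'a list set \<Rightarrow> 'a list set) u v.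
      \<lbrakk>\<And>p q. (p, q) \<in> R \<Longrightarrow> foldr k p = foldr k q; (u, v) \<in> Q\<rbrakk>
      \<Longrightarrow> foldr (\<lambda>b. foldr k (f b)) u = foldr (\<lambda>b. foldr k (f b)) v"
    and gR: "\<And>(k :: 'b \<Rightarrow> 'b list set \<Rightarrow> 'b list set) u v.
      \<lbrakk>\<And>p q. (p, q) \<in> Q \<Longrightarrow> foldr k p = foldr k q; (u, v) \<in> R\<rbrakk>
      \<Longrightarrow> foldr (\<lambda>a. foldr k (g a)) u = foldr (\<lambda>a. foldr k (g a)) v"
    and fg: "\<And>(k :: 'a \<Rightarrow> 'a list set \<Rightarrow> 'a list set) a.
      \<lbrakk>\<And>p q. (p, q) \<in> R \<Longrightarrow> foldr k p = foldr k q; a \<in> A\<rbrakk>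
      \<Longrightarrow> foldr (\<lambda>b. foldr k (f b)) (g a) = k a"
    and gf: "\<And>(k :: 'b \<Rightarrow> 'b list set \<Rightarrow> 'b list set) b.
      \<lbrakk>\<And>p q. (p, q) \<in> Q \<Longrightarrow> foldr k p = foldr k q; b \<in> B\<rbrakk>
      \<Longrightarrow> foldr (\<lambda>a. foldr k (g a)) (f b) = k b"
    and phi: "\<And>b. b \<in> B \<Longrightarrow> \<phi> b = word_class A R (f b)"
  shows "has_monoid_presentation (presented_monoid A R) B Q \<phi>"
proof -
  define F G where "F = (\<lambda>w. concat (map f w))" and "G = (\<lambda>w. concat (map g w))"
  have F: "F w \<in> lists A" if "w \<in> lists B" for w
    using that f unfolding F_def by (induction w) auto
  have G: "G w \<in> lists B" if "w \<in> lists A" for w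
    using that g unfolding G_def by (induction w) auto
  have congF: "(F u, F v) \<in> word_cong A R" if uv: "(u, v) \<in> word_cong B Q" for u v
  proof (rule word_congI_act[OF R])
    show "F u \<in> lists A" "F v \<in> lists A" using F uv word_cong_subset[OF Q] by auto
    fix k :: "'a \<Rightarrow> 'a list set \<Rightarrow> 'a list set"
    assume "\<And>p q. (p, q) \<in> R \<Longrightarrow> foldr k p = foldr k q"
    then show "foldr k (F u) = foldr k (F v)"
      unfolding F_def foldr_concat_map by (intro word_cong_act[OF uv] fQ)
  qed
  have congG: "(G u, G v) \<in> word_cong B Q" if uv: "(u, v) \<in> word_cong A R" for u v
  proof (rule word_congI_act[OF Q])
    show "G u \<in> lists B" "G v \<in> lists B" using G uv word_cong_subset[OF R] by auto
    fix k :: "'b \<Rightarrow> 'b list set \<Rightarrow> 'b list set"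
    assume "\<And>p q. (p, q) \<in> Q \<Longrightarrow> foldr k p = foldr k q"
    then show "foldr k (G u) = foldr k (G v)"
      unfolding G_def foldr_concat_map by (intro word_cong_act[OF uv] gR)
  qed
  have FG: "(F (G w), w) \<in> word_cong A R" if w: "w \<in> lists A" for w
  proof (rule word_congI_act[OF R])
    show "F (G w) \<in> lists A" "w \<in> lists A" using F G w by auto
    fix k :: "'a \<Rightarrow> 'a list set \<Rightarrow> 'a list set"
    assume k: "\<And>p q. (p, q) \<in> R \<Longrightarrow> foldr k p = foldr k q"
    show "foldr k (F (G w)) = foldr k w"
      unfolding F_def G_def foldr_concat_map using w fg[OF k]
      by (intro foldr_cong ext) auto
  qed
  have GF: "(G (F w), w) \<in> word_cong B Q" if w: "w \<in> lists B" for w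
  proof (rule word_congI_act[OF Q])
    show "G (F w) \<in> lists B" "w \<in> lists B" using F G w by auto
    fix k :: "'b \<Rightarrow> 'b list set \<Rightarrow> 'b list set"
    assume k: "\<And>p q. (p, q) \<in> Q \<Longrightarrow> foldr k p = foldr k q"
    show "foldr k (G (F w)) = foldr k w"
      unfolding F_def G_def foldr_concat_map using w gf[OF k]
      by (intro foldr_cong ext) auto
  qed
  \<comment> \<open>By \<open>congF\<close> all representatives of a class yield the same class, so
    the union is that class.\<close>
  define h where "h = (\<lambda>U. \<Union>w\<in>U. word_class A R (F w))"
  have h: "h (word_class B Q w) = word_class A R (F w)" if w: "w \<in> lists B" for w
  proof -
    have "word_class A R (F v) = word_class A R (F w)" if "v \<in> word_class B Q w" for v
    proof -
      have "(w, v) \<in> word_cong B Q" using that by (simp add: word_class_def)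
      then have "(F v, F w) \<in> word_cong A R" using congF word_cong.sym by blast
      then show ?thesis
        using word_class_eq_iff[OF R] word_cong_subset[OF R] by blast
    qed
    moreover have "w \<in> word_class B Q w"
      using word_cong.refl[OF w] by (simp add: word_class_def)
    ultimately show ?thesis unfolding h_def by blast
  qed
  have "h \<in> iso (presented_monoid B Q) (presented_monoid A R)"
  proof (rule isoI)
    show hom: "h \<in> hom (presented_monoid B Q) (presented_monoid A R)"
    proof (rule homI)
      fix U V
      assume "U \<in> carrier (presented_monoid B Q)" "V \<in> carrier (presented_monoid B Q)"
      then obtain u v where uv: "u \<in> lists B" "v \<in> lists B"
        and UV: "U = word_class B Q u" "V = word_class B Q v"
        by (auto simp: carrier_presented_monoid)
      have "h (U \<otimes>\<^bsub>presented_monoid B Q\<^esub> V) = word_class A R (F (u @ v))"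
        unfolding UV word_class_mult[OF Q uv] using uv by (intro h) auto
      also have "\<dots> = h U \<otimes>\<^bsub>presented_monoid A R\<^esub> h V"
        unfolding UV h[OF uv(1)] h[OF uv(2)] word_class_mult[OF R F[OF uv(1)] F[OF uv(2)]]
        by (simp add: F_def)
      finally show "h (U \<otimes>\<^bsub>presented_monoid B Q\<^esub> V) = h U \<otimes>\<^bsub>presented_monoid A R\<^esub> h V" .
    next
      fix U assume "U \<in> carrier (presented_monoid B Q)"
      then obtain u where "u \<in> lists B" "U = word_class B Q u"
        by (auto simp: carrier_presented_monoid)
      then show "h U \<in> carrier (presented_monoid A R)"
        by (simp add: h F carrier_presented_monoid imageI del: in_lists_conv_set)
    qed
    show "bij_betw h (carrier (presented_monoid B Q)) (carrier (presented_monoid A R))"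
      unfolding bij_betw_def
    proof
      show "inj_on h (carrier (presented_monoid B Q))"
      proof (rule inj_onI)
        fix U V
        assume "U \<in> carrier (presented_monoid B Q)" "V \<in> carrier (presented_monoid B Q)"
        then obtain u v where uv: "u \<in> lists B" "v \<in> lists B"
          and UV: "U = word_class B Q u" "V = word_class B Q v"
          by (auto simp: carrier_presented_monoid)
        assume "h U = h V"
        then have "(F u, F v) \<in> word_cong A R"
          using uv by (simp add: UV h F word_class_eq_iff[OF R] del: in_lists_conv_set)
        then have "(u, v) \<in> word_cong B Q"
          using congG GF uv by (meson word_cong.sym word_cong.trans)
        then show "U = V" using uv UV word_class_eq_iff[OF Q] by simp
      qed
      have "word_class A R w \<in> h ` carrier (presented_monoid B Q)" if w: "w \<in> lists A" for w
      proof -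
        have "word_class A R w = h (word_class B Q (G w))"
          using w FG[OF w] F G
          by (simp add: h word_class_eq_iff[OF R] word_cong.sym del: in_lists_conv_set)
        then show ?thesis using G[OF w] by (auto simp: carrier_presented_monoid)
      qed
      then have "carrier (presented_monoid A R) \<subseteq> h ` carrier (presented_monoid B Q)"
        by (auto simp: carrier_presented_monoid)
      moreover have "h ` carrier (presented_monoid B Q) \<subseteq> carrier (presented_monoid A R)"
        using hom_in_carrier[OF hom] by auto
      ultimately show "h ` carrier (presented_monoid B Q) = carrier (presented_monoid A R)"
        by blast
    qed
  qed
  moreover have "h (word_class B Q [b]) = \<phi> b" if "b \<in> B" for b
    using that by (simp add: h phi F_def)
  ultimately show ?thesis unfolding has_monoid_presentation_def using Q by blast
qed

section \<open>Conjugation by powers of an invertible map\<close>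

locale invertible_map =
  fixes s s' :: "'b \<Rightarrow> 'b"
  assumes inverse: "s \<circ> s' = id" "s' \<circ> s = id"
begin

lemma funpow_cancel [simp]: "(s ^^ k) ((s' ^^ k) z) = z" "(s' ^^ k) ((s ^^ k) z) = z"
proof -
  have "s (s' z) = z" "s' (s z) = z" for z using inverse by (simp_all add: fun_eq_iff)
  then show "(s ^^ k) ((s' ^^ k) z) = z" "(s' ^^ k) ((s ^^ k) z) = z"
    by (induction k arbitrary: z) (simp_all add: funpow_swap1)
qed

lemma cancel [simp]: "s (s' z) = z" "s' (s z) = z"
  using funpow_cancel[of 1] by simp_all

text \<open>The effect of \<open>shift\<close> on maps, with powers of \<open>s'\<close> in place of
  negative powers of \<open>s\<close>.\<close>

definition cj :: "nat \<Rightarrow> ('b \<Rightarrow> 'b) \<Rightarrow> 'b \<Rightarrow> 'b" where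
  "cj k f = (s ^^ k) \<circ> f \<circ> (s' ^^ k)"

lemma cj_0 [simp]: "cj 0 f = f" by (simp add: cj_def fun_eq_iff)

lemma cj_id [simp]: "cj k id = id" by (simp add: cj_def fun_eq_iff)

lemma cj_comp: "cj k (f \<circ> g) = cj k f \<circ> cj k g"
  by (simp add: cj_def fun_eq_iff)

lemma cj_cj [simp]: "cj k (cj m f) = cj (k + m) f"
proof -
  have "(s' ^^ m) \<circ> (s' ^^ k) = s' ^^ (k + m)" by (metis add.commute funpow_add)
  then show ?thesis by (simp add: cj_def funpow_add fun_eq_iff)
qed

lemma cj_funpow: "cj k f \<circ> (s ^^ k) = (s ^^ k) \<circ> f"
  by (simp add: cj_def fun_eq_iff)

lemma cj_eqI: "cj k f = g" if "(s ^^ k) \<circ> f = g \<circ> (s ^^ k)"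
proof -
  have "(s ^^ k) (f w) = g ((s ^^ k) w)" for w using that by (simp add: fun_eq_iff)
  then show ?thesis by (simp add: cj_def fun_eq_iff)
qed

lemma surj_cj: "surj (cj k f)" if "surj f"
proof -
  have "surj (s ^^ k)" "surj (s' ^^ k)" by (metis funpow_cancel surjI)+
  then show ?thesis unfolding cj_def using that by (intro comp_surj)
qed

lemma cj_commute:
  assumes "cj i f \<circ> g = g \<circ> cj i f"
  shows "cj (k + i) f \<circ> cj k g = cj k g \<circ> cj (k + i) f"
  using arg_cong[OF assms, of "cj k"] by (simp add: cj_comp)

text \<open>If \<open>s\<^sup>n\<close> commutes with \<open>f\<close>, the conjugates of \<open>f\<close> are indexed modulo \<open>n\<close>.\<close>

lemma cj_commute_complement:
  assumes "cj n f = f" "i \<le> n" "cj i f \<circ> g = g \<circ> cj i f"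
  shows "cj (n - i) g \<circ> f = f \<circ> cj (n - i) g"
  using cj_commute[OF assms(3), of "n - i"] assms(1,2) by simp

text \<open>Moving every \<open>s\<close> to the right turns the factors \<open>f\<close> into
  \<open>cj 1 f\<close>, ..., \<open>cj k f\<close>; the outer \<open>s\<close> and
  \<open>s'\<close> lower these indices by one, so that the product starts with
  \<open>f\<close>.\<close>

lemma funpow_comp_eq_foldr_cj:
  "(s \<circ> f) ^^ k = s \<circ> foldr (\<lambda>i. cj i f) [0..<k] \<circ> s' \<circ> s ^^ k"
proof (induction k)
  case (Suc k)
  have "((s \<circ> f) ^^ Suc k) z = (s \<circ> foldr (\<lambda>i. cj i f) [0..<Suc k] \<circ> s' \<circ> s ^^ Suc k) z" for z
  proof -
    have "((s \<circ> f) ^^ Suc k) z = ((s \<circ> f) ^^ k) (s (f z))"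
      by (simp add: funpow_swap1)
    also have "\<dots> = s (foldr (\<lambda>i. cj i f) [0..<k] ((s ^^ k) (f z)))"
      unfolding Suc by (simp add: funpow_swap1[symmetric])
    also have "(s ^^ k) (f z) = cj k f ((s ^^ k) z)" using cj_funpow[of k f] by (simp add: fun_eq_iff)
    also have "s (foldr (\<lambda>i. cj i f) [0..<k] (cj k f ((s ^^ k) z))) =
        (s \<circ> foldr (\<lambda>i. cj i f) [0..<Suc k] \<circ> s' \<circ> s ^^ Suc k) z"
      by simp
    finally show ?thesis .
  qed
  then show ?case by blast
qed (simp add: fun_eq_iff)

lemma funpow_comp_eq_iff:
  assumes "n \<ge> 1"
  shows "s ^^ n = (s \<circ> f) ^^ (n - 1) \<longleftrightarrow> foldr (\<lambda>i. cj i f) [0..<n - 1] = s"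
    (is "_ \<longleftrightarrow> ?F = s")
proof -
  obtain m where n: "n = Suc m" using assms by (cases n) auto
  have "?F = s" if eq: "\<forall>z. (s ^^ Suc m) z = s (?F (s' ((s ^^ m) z)))"
  proof
    fix z
    \<comment> \<open>The argument is chosen to cancel the power \<open>s ^^ m\<close>.\<close>
    have "s' (s (s z)) = s' (s (?F z))"
      using eq[rule_format, of "(s' ^^ m) (s z)"] by (simp add: funpow_swap1[of s m])
    then show "?F z = s z" by simp
  qed
  then show ?thesis
    unfolding funpow_comp_eq_foldr_cj by (auto simp: fun_eq_iff n)
qed

end

section \<open>Relations among the old generators imply those among the new\<close>

locale SB_action =
  fixes n :: nat and k :: "sb_gen \<Rightarrow> 'b \<Rightarrow> 'b"
  assumes n: "n \<ge> 2" and rels: "\<And>p q. (p, q) \<in> SB_rels n \<Longrightarrow> foldr k p = foldr k q"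
begin

abbreviation "sg i \<equiv> k (Sig i)"
abbreviation "sgi i \<equiv> k (SigInv i)"
abbreviation "xx i \<equiv> k (X i)"
definition "s = foldr sg [1..<n]"
definition "s' = foldr sgi (rev [1..<n])"

section \<open>The defining relations as identities between maps\<close>

lemma sg_commute: "sg i \<circ> sg j = sg j \<circ> sg i" if "i \<in> {1..<n}" "j \<in> {1..<n}" "\<bar>int i - int j\<bar> > 1"
  using rels[OF SB_rels.intros(1)[OF that]] by (simp add: fun_eq_iff)

lemma xx_commute: "xx i \<circ> xx j = xx j \<circ> xx i" if "i \<in> {1..<n}" "j \<in> {1..<n}" "\<bar>int i - int j\<bar> > 1"
  using rels[OF SB_rels.intros(2)[OF that]] by (simp add: fun_eq_iff)

lemma xx_sg_commute:
  "xx i \<circ> sg j = sg j \<circ> xx i" if "i \<in> {1..<n}" "j \<in> {1..<n}" "\<bar>int i - int j\<bar> \<noteq> 1"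
  using rels[OF SB_rels.intros(3)[OF that]] by (simp add: fun_eq_iff)

lemma braid: "sg i \<circ> sg (i + 1) \<circ> sg i = sg (i + 1) \<circ> sg i \<circ> sg (i + 1)" if "1 \<le> i" "i + 1 < n"
  using rels[OF SB_rels.intros(4)[OF that]] by (simp add: fun_eq_iff)

lemma braid_xx: "sg i \<circ> sg (i + 1) \<circ> xx i = xx (i + 1) \<circ> sg i \<circ> sg (i + 1)" if "1 \<le> i" "i + 1 < n"
  using rels[OF SB_rels.intros(5)[OF that]] by (simp add: fun_eq_iff)

lemma braid_xx': "sg (i + 1) \<circ> sg i \<circ> xx (i + 1) = xx i \<circ> sg (i + 1) \<circ> sg i" if "1 \<le> i" "i + 1 < n"
  using rels[OF SB_rels.intros(6)[OF that]] by (simp add: fun_eq_iff)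

lemma sg_inverse: "sg i \<circ> sgi i = id" "sgi i \<circ> sg i = id" if "i \<in> {1..<n}"
  using rels[OF SB_rels.intros(7)[OF that]] rels[OF SB_rels.intros(8)[OF that]]
  by (simp_all add: fun_eq_iff)

sublocale invertible_map s s'
proof
  show "s \<circ> s' = id" unfolding s_def s'_def using sg_inverse by (intro foldr_inverse) auto
  have "foldr sgi (rev [1..<n]) \<circ> foldr sg (rev (rev [1..<n])) = id"
    using sg_inverse by (intro foldr_inverse) auto
  then show "s' \<circ> s = id" by (simp add: s_def s'_def)
qed

text \<open>Split \<sigma> around \<sigma>_i \<sigma>_{i+1}: the tail commutes with
  \<open>f\<close>, the middle turns \<open>f\<close> into \<open>g\<close>, and the head commutes
  with \<open>g\<close>.\<close>

lemma s_shift: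
  assumes i: "1 \<le> i" "i + 1 < n"
    and f: "\<And>j. j \<in> {1..<n} \<Longrightarrow> j > i + 1 \<Longrightarrow> sg j \<circ> f = f \<circ> sg j"
    and g: "\<And>j. j \<in> {1..<n} \<Longrightarrow> j < i \<Longrightarrow> sg j \<circ> g = g \<circ> sg j"
    and fg: "sg i \<circ> sg (i + 1) \<circ> f = g \<circ> sg i \<circ> sg (i + 1)"
  shows "s \<circ> f = g \<circ> s"
proof -
  have "[1..<n] = [1..<i] @ [i..<n]"
    using i upt_add_eq_append[of 1 i "n - i"] by simp
  also have "[i..<n] = i # (i + 1) # [i + 2..<n]" using i by (simp add: upt_conv_Cons)
  finally have split: "[1..<n] = [1..<i] @ i # (i + 1) # [i + 2..<n]" .
  have "foldr sg [1..<i] \<circ> g = g \<circ> foldr sg [1..<i]" using i g by (intro foldr_commute) auto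
  moreover have "foldr sg [i + 2..<n] \<circ> f = f \<circ> foldr sg [i + 2..<n]"
    using i f by (intro foldr_commute) auto
  ultimately show ?thesis unfolding s_def split using fg by (simp add: fun_eq_iff)
qed

lemma s_sg: "s \<circ> sg i = sg (i + 1) \<circ> s" if "1 \<le> i" "i + 1 < n"
  using that braid[OF that] by (intro s_shift[of i] sg_commute) auto

lemma s_xx: "s \<circ> xx i = xx (i + 1) \<circ> s" if "1 \<le> i" "i + 1 < n"
  using that braid_xx[OF that] by (intro s_shift[of i] xx_sg_commute[symmetric]) auto

lemma cj_sg: "cj i (sg 1) = sg (i + 1)" if "i + 1 < n"
proof (rule cj_eqI)
  show "(s ^^ i) \<circ> sg 1 = sg (i + 1) \<circ> (s ^^ i)"
    using that
  proof (induction i)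
    case (Suc i)
    then show ?case using s_sg[of "i + 1"] by (simp add: fun_eq_iff)
  qed simp
qed

lemma cj_xx: "cj i (xx 1) = xx (i + 1)" if "i + 1 < n"
proof (rule cj_eqI)
  show "(s ^^ i) \<circ> xx 1 = xx (i + 1) \<circ> (s ^^ i)"
    using that
  proof (induction i)
    case (Suc i)
    then show ?case using s_xx[of "i + 1"] by (simp add: fun_eq_iff)
  qed simp
qed

text \<open>The conjugate is a right inverse of \<sigma>_{i+1} and \<open>sgi (i + 1)\<close> a left
  inverse, so they agree.\<close>

lemma cj_sgi: "cj i (sgi 1) = sgi (i + 1)" if "i + 1 < n"
proof -
  have "sg (i + 1) \<circ> cj i (sgi 1) = id"
    using sg_inverse(1)[of 1] n by (simp only: cj_sg[OF that, symmetric] cj_comp[symmetric]) simp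
  moreover have "sgi (i + 1) \<circ> sg (i + 1) = id" using that by (intro sg_inverse) simp
  ultimately show ?thesis by (metis comp_assoc comp_id id_comp)
qed

lemma foldr_cj_sg: "foldr (\<lambda>i. cj i (sg 1)) [0..<n - 1] = s"
proof -
  have "[1..<n] = map Suc [0..<n - 1]" using n by (simp add: map_Suc_upt)
  then have "s = foldr (\<lambda>i. sg (i + 1)) [0..<n - 1]" by (simp add: s_def foldr_map_fun)
  also have "\<dots> = foldr (\<lambda>i. cj i (sg 1)) [0..<n - 1]"
    by (intro ext foldr_cong) (auto simp: cj_sg[simplified])
  finally show ?thesis ..
qed

text \<open>
  The words \<open>P\<^sub>m = (\<sigma>\<^sub>1 \<dots> \<sigma>\<^sub>m)(\<sigma>\<^sub>1 \<dots> \<sigma>\<^sub>m\<^sub>-\<^sub>1)\<close> satisfy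
  \<open>P\<^sub>m\<^sub>+\<^sub>1 = P\<^sub>m \<sigma>\<^sub>m\<^sub>+\<^sub>1 \<sigma>\<^sub>m\<close>, hence carry \<open>x\<^sub>m\<close> to \<open>x\<^sub>1\<close>; moreover
  \<open>\<sigma>\<^sup>2 = P\<^sub>n\<^sub>-\<^sub>1 \<sigma>\<^sub>n\<^sub>-\<^sub>1\<close>.
\<close>

lemma double_product_xx:
  assumes "m + 1 < n"
  shows "foldr sg [1..<m + 2] \<circ> foldr sg [1..<m + 1] \<circ> xx (m + 1) =
    xx 1 \<circ> foldr sg [1..<m + 2] \<circ> foldr sg [1..<m + 1]"
  using assms
proof (induction m)
  case 0
  then show ?case using xx_sg_commute[of 1 1] by (simp add: fun_eq_iff)
next
  case (Suc m)
  let ?F = "\<lambda>m. foldr sg [1..<m]"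
  \<comment> \<open>\<open>?F m\<close> ends at \<sigma>_{m-1}. Since \<sigma>_{m+2} passes
    \<sigma>_1 ... \<sigma>_m, P_{m+2} = P_{m+1} \<sigma>_{m+2} \<sigma>_{m+1}.\<close>
  have "?F (m + 1) \<circ> sg (m + 2) = sg (m + 2) \<circ> ?F (m + 1)"
    using Suc.prems by (intro foldr_commute sg_commute) auto
  then have P: "?F (m + 3) \<circ> ?F (m + 2) = ?F (m + 2) \<circ> ?F (m + 1) \<circ> sg (m + 2) \<circ> sg (m + 1)"
    by (simp add: fun_eq_iff numeral_3_eq_3)
  have "?F (m + 3) \<circ> ?F (m + 2) \<circ> xx (m + 2)
      = ?F (m + 2) \<circ> ?F (m + 1) \<circ> xx (m + 1) \<circ> sg (m + 2) \<circ> sg (m + 1)"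
    unfolding P using braid_xx'[of "m + 1"] Suc.prems by (simp add: fun_eq_iff)
  also have "\<dots> = xx 1 \<circ> (?F (m + 2) \<circ> ?F (m + 1) \<circ> sg (m + 2) \<circ> sg (m + 1))"
    using Suc by (simp add: fun_eq_iff)
  also have "\<dots> = xx 1 \<circ> ?F (m + 3) \<circ> ?F (m + 2)"
    unfolding P[symmetric] by (simp only: comp_assoc)
  moreover have "Suc m + 2 = m + 3" "Suc m + 1 = m + 2" by simp_all
  ultimately show ?case by (simp only:)
qed

text \<open>\<sigma>^{n-2} carries x_1 to x_{n-1}, and \<sigma>^2 = P_{n-1} \<sigma>_{n-1} carries
  it back, because \<sigma>_{n-1} commutes with x_{n-1}.\<close>

lemma funpow_xx: "(s ^^ n) \<circ> xx 1 = xx 1 \<circ> (s ^^ n)"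
proof -
  obtain m where m: "n = m + 2" using n by (metis add.commute le_iff_add)
  have s: "s = foldr sg [1..<m + 1] \<circ> sg (m + 1)"
  proof -
    have "[1..<n] = [1..<m + 1] @ [m + 1]" by (simp add: m)
    then show ?thesis by (simp add: s_def fun_eq_iff)
  qed
  have "[1..<n] = [1..<m + 2]" by (simp only: m)
  then have "s = foldr sg [1..<m + 2]" by (simp only: s_def)
  then have P: "s \<circ> foldr sg [1..<m + 1] \<circ> xx (m + 1) = xx 1 \<circ> s \<circ> foldr sg [1..<m + 1]"
    using double_product_xx[of m] m by (simp only:)
  have "s \<circ> s \<circ> xx (m + 1) = xx 1 \<circ> s \<circ> s"
  proof -
    have "s \<circ> s \<circ> xx (m + 1) = s \<circ> foldr sg [1..<m + 1] \<circ> xx (m + 1) \<circ> sg (m + 1)"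
      using xx_sg_commute[of "m + 1" "m + 1"] m
      by (subst (2) s) (simp add: fun_eq_iff)
    also have "\<dots> = xx 1 \<circ> s \<circ> (foldr sg [1..<m + 1] \<circ> sg (m + 1))"
      using P by (simp add: fun_eq_iff)
    finally show ?thesis unfolding s[symmetric] .
  qed
  moreover have "(s ^^ m) \<circ> xx 1 = xx (m + 1) \<circ> (s ^^ m)"
    using cj_funpow[of m "xx 1"] cj_xx[of m] m by simp
  moreover have "s ^^ n = s \<circ> s \<circ> (s ^^ m)" by (simp add: m comp_assoc)
  ultimately show ?thesis by (simp add: fun_eq_iff)
qed

section \<open>The new relations checked on maps\<close>

fun new_gen :: "sb_gen' \<Rightarrow> 'b \<Rightarrow> 'b" where
  "new_gen S1 = sg 1"
| "new_gen S1Inv = sgi 1"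
| "new_gen S = s"
| "new_gen SInv = s'"
| "new_gen X1 = xx 1"

lemma foldr_shift: "foldr new_gen (shift i w) = cj i (foldr new_gen w)"
  by (simp add: shift_def foldr_word_pow cj_def fun_eq_iff comp_def)

lemma new_rels:
  assumes "(u, v) \<in> SB_rels' n"
  shows "foldr new_gen u = foldr new_gen v"
  using assms
proof cases
  case (1 i)
  then show ?thesis using sg_commute[of 1 "i + 1"] cj_sg[of i]
    by (simp add: foldr_shift comp_def fun_eq_iff)
next
  case 2
  have "s ^^ n = (s \<circ> sg 1) ^^ (n - 1)"
    using funpow_comp_eq_iff[of n "sg 1"] n foldr_cj_sg by simp
  then show ?thesis by (simp add: 2 foldr_word_pow comp_def)
next
  case (3 i)
  then show ?thesis using xx_sg_commute[of 1 "i + 1"] cj_sg[of i] n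
    by (auto simp: foldr_shift comp_def fun_eq_iff)
next
  case (4 i)
  then show ?thesis using xx_commute[of 1 "i + 1"] cj_xx[of i]
    by (simp add: foldr_shift comp_def fun_eq_iff)
next
  case 5
  then show ?thesis using funpow_xx by (simp add: foldr_word_pow comp_def fun_eq_iff)
next
  case 6
  \<comment> \<open>For n = 2 there is no \<sigma>_2, but \<sigma> = \<sigma>_1 commutes with x_1.
    Otherwise the relation reads x_1 \<sigma>_2 \<sigma>_1 = \<sigma>_2 \<sigma>_1 x_2.\<close>
  show ?thesis
  proof (cases "n = 2")
    case True
    then have "[1..<n] = [1]" by (simp add: numeral_2_eq_2)
    then have "s = sg 1" by (simp add: s_def fun_eq_iff)
    moreover have "xx 1 \<circ> sg 1 = sg 1 \<circ> xx 1" using n by (intro xx_sg_commute) auto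
    ultimately have "s (xx 1 z) = xx 1 (s z)" "sg 1 = s" for z by (simp_all add: fun_eq_iff)
    then show ?thesis by (simp add: 6 fun_eq_iff)
  next
    case False
    then have "s (sg 1 (s' z)) = sg 2 z" "s (xx 1 (s' z)) = xx 2 z" for z
      using n cj_sg[of 1] cj_xx[of 1] by (simp_all add: cj_def fun_eq_iff numeral_2_eq_2)
    moreover have "sg 2 (sg 1 (xx 2 z)) = xx 1 (sg 2 (sg 1 z))" for z
      using False n braid_xx'[of 1] by (simp add: fun_eq_iff numeral_2_eq_2)
    ultimately show ?thesis by (simp add: 6 fun_eq_iff)
  qed
next
  case 7
  then show ?thesis using sg_inverse(1)[of 1] n by (simp add: fun_eq_iff)
next
  case 8
  then show ?thesis using sg_inverse(2)[of 1] n by (simp add: fun_eq_iff)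
qed (simp_all add: fun_eq_iff)

end

section \<open>Relations among the new generators imply those among the old\<close>

locale SB'_action =
  fixes n :: nat and k :: "sb_gen' \<Rightarrow> 'b \<Rightarrow> 'b"
  assumes n: "n \<ge> 2" and rels: "\<And>p q. (p, q) \<in> SB_rels' n \<Longrightarrow> foldr k p = foldr k q"
begin

sublocale invertible_map "k S" "k SInv"
  using rels[OF SB_rels'.intros(9)] rels[OF SB_rels'.intros(10)]
  by unfold_locales (simp_all add: fun_eq_iff)

lemma foldr_shift: "foldr k (shift i w) = cj i (foldr k w)"
  by (simp add: shift_def foldr_word_pow cj_def fun_eq_iff comp_def)

lemma foldr_cj_S1: "foldr (\<lambda>i. cj i (k S1)) [0..<n - 1] = k S"
  using rels[OF SB_rels'.intros(2)] funpow_comp_eq_iff[of n "k S1"] n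
  by (simp add: foldr_word_pow comp_def)

lemma S1_inverse: "k S1 \<circ> k S1Inv = id" "k S1Inv \<circ> k S1 = id"
  using rels[OF SB_rels'.intros(7)] rels[OF SB_rels'.intros(8)] by (simp_all add: fun_eq_iff)

lemma cj_n_X1: "cj n (k X1) = k X1"
  using rels[OF SB_rels'.intros(5)] by (intro cj_eqI) (simp add: foldr_word_pow fun_eq_iff)

text \<open>\<open>\<sigma>\<^sup>n\<close> commutes with \<open>\<sigma>\<sigma>\<^sub>1\<close>, being a power of it.\<close>

lemma cj_n_S1: "cj n (k S1) = k S1"
proof (rule cj_eqI)
  have pow: "k S ^^ n = (k S \<circ> k S1) ^^ (n - 1)"
    using rels[OF SB_rels'.intros(2)] by (simp add: foldr_word_pow comp_def)
  have "(k S ^^ n) (k S (k S1 z)) = k S (k S1 ((k S ^^ n) z))" for z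
    unfolding pow using funpow_swap1[of "k S \<circ> k S1" "n - 1" z] by simp
  then have "k SInv (k S ((k S ^^ n) (k S1 z))) = k SInv (k S (k S1 ((k S ^^ n) z)))" for z
    by (simp only: funpow_swap1)
  then show "(k S ^^ n) \<circ> k S1 = k S1 \<circ> (k S ^^ n)" by (simp only: cancel) (simp add: fun_eq_iff)
qed

text \<open>If 2i > n, then n - i lies between 2 and n/2, and \<open>cj_commute_complement\<close>
  turns the commutation at n - i into that at i.\<close>

lemma cj_commute_extend:
  assumes "cj n f = f" "2 \<le> i" "i + 2 \<le> n"
    and "\<And>i. \<lbrakk>2 \<le> i; 2 * i \<le> n\<rbrakk> \<Longrightarrow> f \<circ> cj i f = cj i f \<circ> f"
  shows "cj i f \<circ> f = f \<circ> cj i f"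
proof (cases "2 * i \<le> n")
  case True
  then show ?thesis using assms by simp
next
  case False
  then have "cj (n - (n - i)) f \<circ> f = f \<circ> cj (n - (n - i)) f"
    using assms by (intro cj_commute_complement assms(1) assms(4)[symmetric]) auto
  then show ?thesis using assms(3) by simp
qed

lemma S1_S1: "cj i (k S1) \<circ> k S1 = k S1 \<circ> cj i (k S1)" if "2 \<le> i" "i + 2 \<le> n"
proof (rule cj_commute_extend[OF cj_n_S1 that])
  fix i assume "2 \<le> i" "2 * i \<le> n"
  from rels[OF SB_rels'.intros(1)[OF this]]
  show "k S1 \<circ> cj i (k S1) = cj i (k S1) \<circ> k S1" by (simp add: foldr_shift comp_def fun_eq_iff)
qed

lemma X1_X1: "cj i (k X1) \<circ> k X1 = k X1 \<circ> cj i (k X1)" if "2 \<le> i" "i + 2 \<le> n"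
proof (rule cj_commute_extend[OF cj_n_X1 that])
  fix i assume "2 \<le> i" "2 * i \<le> n"
  from rels[OF SB_rels'.intros(4)[OF this]]
  show "k X1 \<circ> cj i (k X1) = cj i (k X1) \<circ> k X1" by (simp add: foldr_shift comp_def fun_eq_iff)
qed

lemma S1_X1: "cj i (k S1) \<circ> k X1 = k X1 \<circ> cj i (k S1)" if "i = 0 \<or> 2 \<le> i \<and> i + 2 \<le> n"
  using rels[OF SB_rels'.intros(3)[OF that]] by (simp add: foldr_shift comp_def fun_eq_iff)

text \<open>The range 2, ..., n - 2 is stable under replacing i by n - i, so reflecting
  \<open>S1_X1\<close> moves the conjugation from \<sigma>_1 to x_1.\<close>

lemma X1_S1: "cj i (k X1) \<circ> k S1 = k S1 \<circ> cj i (k X1)" if "2 \<le> i" "i + 2 \<le> n"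
proof -
  have "cj (n - (n - i)) (k X1) \<circ> k S1 = k S1 \<circ> cj (n - (n - i)) (k X1)"
    using that by (intro cj_commute_complement cj_n_S1 S1_X1) auto
  then show ?thesis using that by simp
qed

text \<open>With \<open>\<sigma> = \<sigma>\<^sub>1 \<sigma>\<^sub>2 ?G\<close> and \<open>?G\<close> commuting with \<open>f\<close>, cancel \<open>?G\<close> in \<open>\<sigma> f = (\<sigma> f \<sigma>\<^sup>-\<^sup>1) \<sigma>\<close>.\<close>

lemma braid_general:
  assumes "n \<ge> 3" and f: "\<And>i. \<lbrakk>2 \<le> i; i + 2 \<le> n\<rbrakk> \<Longrightarrow> cj i (k S1) \<circ> f = f \<circ> cj i (k S1)"
  shows "k S1 \<circ> cj 1 (k S1) \<circ> f = cj 1 f \<circ> k S1 \<circ> cj 1 (k S1)"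
proof -
  let ?G = "foldr (\<lambda>i. cj i (k S1)) [2..<n - 1]"
  have "[0..<n - 1] = 0 # 1 # [2..<n - 1]"
    using assms(1) by (simp add: upt_conv_Cons numeral_2_eq_2)
  then have S: "k S = k S1 \<circ> cj 1 (k S1) \<circ> ?G"
    using foldr_cj_S1 by (simp add: fun_eq_iff)
  have G: "?G \<circ> f = f \<circ> ?G" using f by (intro foldr_commute) auto
  have "(k S1 \<circ> cj 1 (k S1) \<circ> ?G) \<circ> f = cj 1 f \<circ> (k S1 \<circ> cj 1 (k S1) \<circ> ?G)"
    unfolding S[symmetric] using cj_funpow[of 1 f] by simp
  then have eq: "k S1 \<circ> cj 1 (k S1) \<circ> f \<circ> ?G = cj 1 f \<circ> k S1 \<circ> cj 1 (k S1) \<circ> ?G"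
    using G by (simp add: fun_eq_iff)
  \<comment> \<open>Right cancellation of \<open>?G\<close> works because it is onto: every argument
    has the form \<open>?G w\<close>.\<close>
  have "surj (k S1)" using S1_inverse(1) by (intro surjI[of _ "k S1Inv"]) (simp add: fun_eq_iff)
  then have surj: "surj ?G" by (intro surj_foldr surj_cj)
  show ?thesis
  proof
    fix z
    obtain w where "z = ?G w" using surj by (metis surjD)
    then show "(k S1 \<circ> cj 1 (k S1) \<circ> f) z = (cj 1 f \<circ> k S1 \<circ> cj 1 (k S1)) z"
      using fun_cong[OF eq, of w] by simp
  qed
qed

section \<open>The old relations checked on conjugates\<close>

fun old_gen :: "sb_gen \<Rightarrow> 'b \<Rightarrow> 'b" where
  "old_gen (Sig i) = cj (i - 1) (k S1)"
| "old_gen (SigInv i) = cj (i - 1) (k S1Inv)"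
| "old_gen (X i) = cj (i - 1) (k X1)"

text \<open>Conjugation reduces the smaller index to 1. Whether \<open>f\<close> or \<open>g\<close>
  then stays conjugated depends on the order of i and j, hence the two hypotheses.\<close>

lemma commute_old:
  assumes ij: "i \<in> {1..<n}" "j \<in> {1..<n}" "\<bar>int i - int j\<bar> \<noteq> 1"
    and 0: "i = j \<Longrightarrow> f \<circ> g = g \<circ> f"
    and f: "\<And>i. \<lbrakk>2 \<le> i; i + 2 \<le> n\<rbrakk> \<Longrightarrow> cj i f \<circ> g = g \<circ> cj i f"
    and g: "\<And>i. \<lbrakk>2 \<le> i; i + 2 \<le> n\<rbrakk> \<Longrightarrow> cj i g \<circ> f = f \<circ> cj i g"
  shows "cj (i - 1) f \<circ> cj (j - 1) g = cj (j - 1) g \<circ> cj (i - 1) f"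
proof -
  consider "i = j" | "i \<ge> j + 2" | "j \<ge> i + 2" using ij by linarith
  then show ?thesis
  proof cases
    case 1
    then show ?thesis using 0 by (metis cj_comp)
  next
    case 2
    then show ?thesis using cj_commute[OF f[of "i - j"], of "j - 1"] ij by auto
  next
    case 3
    then show ?thesis using cj_commute[OF g[of "j - i"], of "i - 1"] ij by auto
  qed
qed

lemma old_rels:
  assumes "(u, v) \<in> SB_rels n"
  shows "foldr old_gen u = foldr old_gen v"
  using assms
proof cases
  case (1 i j)
  then have "old_gen (Sig i) \<circ> old_gen (Sig j) = old_gen (Sig j) \<circ> old_gen (Sig i)"
    unfolding old_gen.simps by (intro commute_old S1_S1) auto
  then show ?thesis by (simp add: 1 fun_eq_iff)
next
  case (2 i j)
  then have "old_gen (X i) \<circ> old_gen (X j) = old_gen (X j) \<circ> old_gen (X i)"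
    unfolding old_gen.simps by (intro commute_old X1_X1) auto
  then show ?thesis by (simp add: 2 fun_eq_iff)
next
  case (3 i j)
  then have "old_gen (X i) \<circ> old_gen (Sig j) = old_gen (Sig j) \<circ> old_gen (X i)"
    unfolding old_gen.simps using S1_X1[of 0]
    by (intro commute_old X1_S1 S1_X1) auto
  then show ?thesis by (simp add: 3 fun_eq_iff)
next
  case (4 i)
  \<comment> \<open>Here and in the next two cases the relation is obtained for i = 1 and then
    conjugated by \<sigma>^{i-1}.\<close>
  have "k S1 \<circ> cj 1 (k S1) \<circ> k S1 = cj 1 (k S1) \<circ> k S1 \<circ> cj 1 (k S1)"
    using 4 by (intro braid_general S1_S1) auto
  from arg_cong[OF this, of "cj (i - 1)"] 4 show ?thesis by (simp add: cj_comp fun_eq_iff)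
next
  case (5 i)
  have "k S1 \<circ> cj 1 (k S1) \<circ> k X1 = cj 1 (k X1) \<circ> k S1 \<circ> cj 1 (k S1)"
    using 5 by (intro braid_general S1_X1) auto
  from arg_cong[OF this, of "cj (i - 1)"] 5 show ?thesis by (simp add: cj_comp fun_eq_iff)
next
  case (6 i)
  \<comment> \<open>This is the new relation itself, with \<sigma> and its inverse absorbed into
    conjugations.\<close>
  have "cj 1 (k S1) \<circ> k S1 \<circ> cj 1 (k X1) = k X1 \<circ> cj 1 (k S1) \<circ> k S1"
    using rels[OF SB_rels'.intros(6)] by (simp add: cj_def fun_eq_iff)
  from arg_cong[OF this, of "cj (i - 1)"] 6 show ?thesis by (simp add: cj_comp fun_eq_iff)
next
  case (7 i)
  show ?thesis using arg_cong[OF S1_inverse(1), of "cj (i - 1)"]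
    by (simp add: 7 cj_comp fun_eq_iff)
next
  case (8 i)
  show ?thesis using arg_cong[OF S1_inverse(2), of "cj (i - 1)"]
    by (simp add: 8 cj_comp fun_eq_iff)
qed

lemma foldr_old_gen_Sig: "foldr old_gen (map Sig [1..<n]) = k S"
proof -
  have "[1..<n] = map Suc [0..<n - 1]" using n by (simp add: map_Suc_upt)
  then show ?thesis using foldr_cj_S1 by (simp add: foldr_map_fun)
qed

text \<open>The product is a right inverse of \<sigma>, and \<open>k SInv\<close> is a left
  inverse.\<close>

lemma foldr_old_gen_SigInv: "foldr old_gen (map SigInv (rev [1..<n])) = k SInv"
proof -
  have "foldr (\<lambda>i. old_gen (Sig i)) [1..<n] \<circ> foldr (\<lambda>i. old_gen (SigInv i)) (rev [1..<n]) = id"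
    using S1_inverse by (intro foldr_inverse) (simp add: cj_comp[symmetric])
  then have "k S \<circ> foldr old_gen (map SigInv (rev [1..<n])) = id"
    using foldr_old_gen_Sig by (simp only: foldr_map_fun)
  then show ?thesis using inverse(2) by (metis comp_assoc comp_id id_comp)
qed

end

section \<open>The presentation\<close>

fun old_word :: "nat \<Rightarrow> sb_gen' \<Rightarrow> sb_gen list" where
  "old_word n S1 = [Sig 1]"
| "old_word n S1Inv = [SigInv 1]"
| "old_word n S = map Sig [1..<n]"
| "old_word n SInv = map SigInv (rev [1..<n])"
| "old_word n X1 = [X 1]"

fun new_word :: "sb_gen \<Rightarrow> sb_gen' list" where
  "new_word (Sig i) = shift (i - 1) [S1]"
| "new_word (SigInv i) = shift (i - 1) [S1Inv]"
| "new_word (X i) = shift (i - 1) [X1]"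

lemma SB_rels'_subset:
  "SB_rels' n \<subseteq> lists {S1, S1Inv, S, SInv, X1} \<times> lists {S1, S1Inv, S, SInv, X1}"
  by (auto simp: shift_def elim!: SB_rels'.cases split: if_splits)

lemma (in SB_action) foldr_old_word: "(\<lambda>b. foldr k (old_word n b)) = new_gen"
proof
  show "foldr k (old_word n b) = new_gen b" for b
    by (cases b) (auto simp: fun_eq_iff foldr_map_fun s_def s'_def)
qed

lemma (in SB'_action) foldr_new_word: "(\<lambda>a. foldr k (new_word a)) = old_gen"
proof
  show "foldr k (new_word a) = old_gen a" for a
    by (cases a) (auto simp: foldr_shift comp_def)
qed

theorem theorem1:
  fixes n :: nat
  assumes "n \<ge> 2"
  shows "has_monoid_presentation (SB n) {S1, S1Inv, S, SInv, X1} (SB_rels' n) (SB_interp n)"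
  unfolding SB_def
proof (rule has_monoid_presentationI[where f = "old_word n" and g = new_word])
  show "old_word n b \<in> lists (SB_gens n)" if "b \<in> {S1, S1Inv, S, SInv, X1}" for b
    using assms by (cases b) (auto simp: SB_gens_def)
  show "new_word a \<in> lists {S1, S1Inv, S, SInv, X1}" for a
    by (cases a) (auto simp: shift_def)
  show "SB_interp n b = SB_class n (old_word n b)" for b
    by (cases b) auto
next
  fix k :: "sb_gen \<Rightarrow> sb_gen list set \<Rightarrow> sb_gen list set"
  assume "\<And>p q. (p, q) \<in> SB_rels n \<Longrightarrow> foldr k p = foldr k q"
  then interpret SB_action n k using assms by unfold_locales
  show "foldr (\<lambda>b. foldr k (old_word n b)) u = foldr (\<lambda>b. foldr k (old_word n b)) v"
    if "(u, v) \<in> SB_rels' n" for u v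
    unfolding foldr_old_word using that by (rule new_rels)
  \<comment> \<open>The round trip sends a generator of index i to the conjugate by \<sigma>^{i-1}
    of the one of index 1.\<close>
  show "foldr (\<lambda>b. foldr k (old_word n b)) (new_word a) = k a" if "a \<in> SB_gens n" for a
    unfolding foldr_old_word using that
    by (cases a)
      (auto simp: SB_gens_def foldr_shift comp_def cj_sg[simplified] cj_sgi[simplified]
        cj_xx[simplified])
next
  fix k :: "sb_gen' \<Rightarrow> sb_gen' list set \<Rightarrow> sb_gen' list set"
  assume "\<And>p q. (p, q) \<in> SB_rels' n \<Longrightarrow> foldr k p = foldr k q"
  then interpret SB'_action n k using assms by unfold_locales
  show "foldr (\<lambda>a. foldr k (new_word a)) u = foldr (\<lambda>a. foldr k (new_word a)) v"
    if "(u, v) \<in> SB_rels n" for u v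
    unfolding foldr_new_word using that by (rule old_rels)
  show "foldr (\<lambda>a. foldr k (new_word a)) (old_word n b) = k b" for b
    unfolding foldr_new_word using foldr_old_gen_Sig foldr_old_gen_SigInv
    by (cases b) (simp_all add: fun_eq_iff)
qed (fact SB_rels_subset SB_rels'_subset)+

end
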